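(* For every real $\gamma>0$ and every factorization $C=FF^\top$ (with $F\in\mathbb{R}^{n\times k}$, $r\le k\le n$), $$z_{\mathrm{DFact}}(C,s,A,b;F)=z_{\mathrm{DFact}}(\gamma C,s,A,b;\sqrt{\gamma}\,F)-s\log\gamma .$$
   Context: Let $n>1$, $0<s<n$ be integers, let $C$ be a real symmetric positive semidefinite $n\times n$ matrix of rank $r\ge s$, and let $A\in\mathbb{R}^{m\times n}$, $b\in\mathbb{R}^m$. A factorization of $C$ is an identity $C=FF^\top$ with $F\in\mathbb{R}^{n\times k}$ for some $k$ with $r\le k\le n$. For a symmetric matrix $M$, $\lambda_\ell(M)$ is its $\ell$-th greatest eigenvalue (with multiplicity); $\operatorname{diag}(M)$ is the vector of diagonal entries of $M$; $\mathbf{e}$ is the all-ones vector; $\log$ is the natural logarithm; vector inequalities are componentwise. For $\Theta$ symmetric positive definite of order $k$, $\nu\in\mathbb{R}^n$, $\pi\in\mathbb{R}^m$, $\tau\in\mathbb{R}$, let $$f(\Theta,\nu,\pi,\tau):=-\sum_{\ell=k-s+1}^{k}\log\lambda_\ell(\Theta)+\nu^\top\mathbf{e}+\pi^\top b+\tau s-s .$$ The factorization bound $z_{\mathrm{DFact}}(C,s,A,b;F)$ is the optimal value (infimum, in the extended reals) of: minimize $f(\Theta,\nu,\pi,\tau)$ over symmetric $\Theta\in\mathbb{R}^{k\times k}$, $\upsilon,\nu\in\mathbb{R}^n$, $\pi\in\mathbb{R}^m$, $\tau\in\mathbb{R}$, subject to $$\operatorname{diag}(F\Theta F^\top)+\upsilon-\nu-A^\top\pi-\tau\mathbf{e}=0,\qquad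 \Theta\succ0,\ \upsilon\ge0,\ \nu\ge0,\ \pi\ge0 .$$ *)

theory Defs
  imports
    "Jordan_Normal_Form.Char_Poly"
    "Jordan_Normal_Form.DL_Rank"
    "HOL-Library.Extended_Real"
begin

definition sym_mat :: "real mat \<Rightarrow> bool" where
  "sym_mat M \<longleftrightarrow> square_mat M \<and> M\<^sup>T = M"

definition psd_mat :: "real mat \<Rightarrow> bool" where
  "psd_mat M \<longleftrightarrow> sym_mat M \<and> (\<forall>x \<in> carrier_vec (dim_row M). 0 \<le> x \<bullet> (M *\<^sub>v x))"

definition pd_mat :: "real mat \<Rightarrow> bool" where
  "pd_mat M \<longleftrightarrow> sym_mat M \<and>
     (\<forall>x \<in> carrier_vec (dim_row M). x \<noteq> 0\<^sub>v (dim_row M) \<longrightarrow> 0 < x \<bullet> (M *\<^sub>v x))"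

text \<open>The \<open>l\<close>-th greatest eigenvalue, counted from \<open>l = 1\<close>. Roots of the characteristic polynomial
  carry their algebraic multiplicity; for a symmetric matrix of order \<open>k\<close> there are exactly \<open>k\<close> of
  them, so the value is meaningful for \<open>1 \<le> l \<le> k\<close>.\<close>

definition eig :: "nat \<Rightarrow> real mat \<Rightarrow> real" where
  "eig l M = rev (sorted_list_of_multiset (proots (char_poly M))) ! (l - 1)"

definition diag_vec :: "'a mat \<Rightarrow> 'a vec" where
  "diag_vec M = vec (dim_row M) (\<lambda>i. M $$ (i, i))"

definition ones_vec :: "nat \<Rightarrow> real vec" where
  "ones_vec n = vec n (\<lambda>i. 1)"

text \<open>The order \<open>k\<close> is that of \<open>\<Theta>\<close>. Since \<open>k\<close> and \<open>s\<close> are natural numbers, the lower summation bound is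
  the intended one only for \<open>s \<le> k\<close>.\<close>

definition DFact_objective ::
  "nat \<Rightarrow> real vec \<Rightarrow> real mat \<Rightarrow> real vec \<Rightarrow> real vec \<Rightarrow> real \<Rightarrow> real" where
  "DFact_objective s b \<Theta> \<nu> \<pi> \<tau> =
     - (\<Sum>l = dim_row \<Theta> - s + 1..dim_row \<Theta>. ln (eig l \<Theta>))
     + \<nu> \<bullet> ones_vec (dim_vec \<nu>) + \<pi> \<bullet> b + \<tau> * real s - real s"

text \<open>Here \<open>n = dim_row C\<close>, \<open>m = dim_row A\<close> and \<open>k = dim_col F\<close>. The program depends on \<open>C\<close> only
  through its order \<open>n\<close> and the factor \<open>F\<close>; that \<open>F\<close> factorizes \<open>C\<close> is left to the user of
  these definitions. The order on vectors is componentwise.\<close>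

definition DFact_feasible ::
  "real mat \<Rightarrow> real mat \<Rightarrow> real mat \<Rightarrow> (real mat \<times> real vec \<times> real vec \<times> real vec \<times> real) set" where
  "DFact_feasible C A F =
     {(\<Theta>, \<upsilon>, \<nu>, \<pi>, \<tau>).
        \<Theta> \<in> carrier_mat (dim_col F) (dim_col F) \<and>
        \<upsilon> \<in> carrier_vec (dim_row C) \<and> \<nu> \<in> carrier_vec (dim_row C) \<and> \<pi> \<in> carrier_vec (dim_row A) \<and>
        diag_vec (F * \<Theta> * F\<^sup>T) + \<upsilon> - \<nu> - A\<^sup>T *\<^sub>v \<pi> - \<tau> \<cdot>\<^sub>v ones_vec (dim_row C)
          = 0\<^sub>v (dim_row C) \<and>
        pd_mat \<Theta> \<and> 0\<^sub>v (dim_row C) \<le> \<upsilon> \<and> 0\<^sub>v (dim_row C) \<le> \<nu> \<and> 0\<^sub>v (dim_row A) \<le> \<pi>}"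

definition z_DFact :: "real mat \<Rightarrow> nat \<Rightarrow> real mat \<Rightarrow> real vec \<Rightarrow> real mat \<Rightarrow> ereal" where
  "z_DFact C s A b F =
     (INF (\<Theta>, \<upsilon>, \<nu>, \<pi>, \<tau>) \<in> DFact_feasible C A F. ereal (DFact_objective s b \<Theta> \<nu> \<pi> \<tau>))"

end

theory Submission
  imports Defs
begin

text \<open>The map \<open>\<Theta> \<mapsto> \<Theta> / \<gamma>\<close> carries the feasible points for \<open>(C, F)\<close> to those for
  \<open>(\<gamma>C, \<surd>\<gamma> F)\<close>, since \<open>\<surd>\<gamma> F (\<Theta> / \<gamma>) (\<surd>\<gamma> F)\<^sup>T = F \<Theta> F\<^sup>T\<close>. It divides every
  eigenvalue by \<open>\<gamma>\<close>, so the objective, which sums \<open>s\<close> logarithms, grows by \<open>s log \<gamma>\<close>. This gives one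
  inequality; the other is the same inequality for \<open>(\<gamma>C, \<surd>\<gamma> F)\<close> and \<open>1 / \<gamma>\<close>.
  Because eigenvalues are entries of a list of real roots, the scaling argument needs that
  the characteristic polynomial of a real symmetric matrix splits over the reals.\<close>

lemma proots_linear_factors:
  fixes R :: "'a :: idom multiset"
  shows "proots (\<Prod>a\<in>#R. [:- a, 1:]) = R"
proof (induction R)
  case (add x R)
  have "(\<Prod>a\<in>#R. [:- a, 1:]) \<noteq> 0"
    by (auto simp: prod_mset_zero_iff)
  then show ?case
    using add by (simp add: proots_mult del: mult_pCons_left)
qed simp

lemma degree_linear_factors:
  fixes R :: "'a :: idom multiset"
  shows "degree (\<Prod>a\<in>#R. [:- a, 1:]) = size R"
proof (induction R)
  case (add x R)
  have "(\<Prod>a\<in>#R. [:- a, 1:]) \<noteq> 0"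
    by (auto simp: prod_mset_zero_iff)
  then show ?case
    using add by (simp add: degree_mult_eq del: mult_pCons_left)
qed simp

text \<open>Induction on the degree: a nonconstant \<open>p\<close> has a complex root by the
  fundamental theorem of algebra. This root is real by assumption, so a linear factor splits off
  over the reals. The quotient inherits the assumption because its complex roots are roots of
  \<open>p\<close>.\<close>

lemma poly_splits_if_complex_roots_real:
  fixes p :: "real poly"
  assumes "\<And>z. poly (map_poly complex_of_real p) z = 0 \<Longrightarrow> z \<in> \<real>"
  shows "\<exists>R. p = Polynomial.smult (lead_coeff p) (\<Prod>a\<in>#R. [:- a, 1:])"
  using assms
proof (induction "degree p" arbitrary: p rule: less_induct)
  case less
  interpret of_real_poly: map_poly_comm_ring_hom complex_of_real ..
  show ?case
  proof (cases "degree p = 0")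
    case True
    then obtain c where "p = [:c:]"
      by (rule degree_eq_zeroE)
    then show ?thesis
      by (intro exI[of _ "{#}"]) simp
  next
    case False
    then have "\<not> constant (poly (map_poly complex_of_real p))"
      by (simp add: constant_degree)
    then obtain z where z: "poly (map_poly complex_of_real p) z = 0"
      using fundamental_theorem_of_algebra by blast
    then obtain a where a: "z = complex_of_real a"
      using less.prems Reals_cases by blast
    with z have "poly p a = 0"
      by (simp flip: of_real_hom.poly_map_poly_1)
    then obtain q where q: "p = [:- a, 1:] * q"
      by (auto simp: poly_eq_0_iff_dvd)
    have "q \<noteq> 0"
      using False q by auto
    then have "degree q < degree p"
      unfolding q by (subst degree_mult_eq) auto
    moreover have "z \<in> \<real>" if "poly (map_poly complex_of_real q) z = 0" for z
      using that less.prems[of z] unfolding q of_real_poly.hom_mult by simp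
    ultimately obtain R where R: "q = Polynomial.smult (lead_coeff q) (\<Prod>a\<in>#R. [:- a, 1:])"
      using less.hyps by blast
    have "lead_coeff p = lead_coeff q"
      unfolding q by (simp add: lead_coeff_mult del: mult_pCons_left)
    then have "p = Polynomial.smult (lead_coeff p) ([:- a, 1:] * (\<Prod>a\<in>#R. [:- a, 1:]))"
      by (metis R q mult_smult_right)
    then show ?thesis
      by (intro exI[of _ "add_mset a R"]) simp
  qed
qed

text \<open>The Hermitian argument: moving \<open>?M\<close> across the product of \<open>v\<close>
  with its conjugate gives both \<open>z\<close> and \<open>cnj z\<close> times the same nonzero
  number.\<close>

lemma sym_mat_complex_eigenvalue_real:
  assumes M: "M \<in> carrier_mat n n" and sym: "sym_mat M"
    and ev: "eigenvalue (map_mat complex_of_real M) z"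
  shows "z \<in> \<real>"
proof -
  let ?M = "map_mat complex_of_real M"
  obtain v where v: "v \<in> carrier_vec n" "v \<noteq> 0\<^sub>v n" "?M *\<^sub>v v = z \<cdot>\<^sub>v v"
    using ev M unfolding eigenvalue_def eigenvector_def by auto
  have M': "?M \<in> carrier_mat n n" "?M\<^sup>T = ?M"
    using M sym unfolding sym_mat_def by (auto simp: map_mat_transpose)
  \<comment> \<open>The entries of \<open>?M\<close> are real, so conjugation passes through
    it.\<close>
  have cMv: "conjugate (?M *\<^sub>v v) = ?M *\<^sub>v conjugate v"
    using M v(1) by (intro eq_vecI) (auto simp: scalar_prod_def sum_conjugate conjugate_dist_mul)
  have "z * (v \<bullet> conjugate v) = (?M *\<^sub>v v) \<bullet> conjugate v"
    using v by simp
  also have "\<dots> = v \<bullet> conjugate (?M *\<^sub>v v)"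
    unfolding cMv using transpose_vec_mult_scalar[OF M'(1), of "conjugate v" v] v(1) M'(2) by simp
  also have "\<dots> = cnj z * (v \<bullet> conjugate v)"
    using v by (simp add: conjugate_smult_vec)
  finally have "z = cnj z"
    using v(1,2) by (simp add: conjugate_square_eq_0_vec)
  then show ?thesis
    by (simp add: Reals_cnj_iff)
qed

text \<open>Complex roots are eigenvalues of the complexified matrix, hence real, and monicity
  removes the leading coefficient. The root count keeps the list lookup in \<open>eig\<close> within
  range.\<close>

lemma sym_mat_char_poly_splits:
  assumes M: "M \<in> carrier_mat n n" and sym: "sym_mat M"
  shows "char_poly M = (\<Prod>a\<in>#proots (char_poly M). [:- a, 1:])"
    and "size (proots (char_poly M)) = n"
proof -
  have "z \<in> \<real>" if "poly (map_poly complex_of_real (char_poly M)) z = 0" for z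
  proof -
    have "eigenvalue (map_mat complex_of_real M) z"
      using that M by (subst eigenvalue_root_char_poly[of _ n])
        (auto simp: of_real_hom.char_poly_hom[OF M])
    then show ?thesis
      using sym_mat_complex_eigenvalue_real[OF M sym] by blast
  qed
  then obtain R where R: "char_poly M = (\<Prod>a\<in>#R. [:- a, 1:])"
    using poly_splits_if_complex_roots_real[of "char_poly M"] degree_monic_char_poly[OF M] by auto
  then show "char_poly M = (\<Prod>a\<in>#proots (char_poly M). [:- a, 1:])"
    by (simp add: proots_linear_factors)
  show "size (proots (char_poly M)) = n"
    using degree_monic_char_poly[OF M] R by (simp add: proots_linear_factors degree_linear_factors)
qed

text \<open>The matrix \<open>cxI - cM\<close> is \<open>c\<close> times \<open>xI - M\<close>, and
  a determinant of order \<open>n\<close> is homogeneous of degree \<open>n\<close>.\<close>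

lemma poly_char_poly_smult:
  fixes M :: "'a :: field mat"
  assumes M: "M \<in> carrier_mat n n" and c: "c \<noteq> 0"
  shows "poly (char_poly (c \<cdot>\<^sub>m M)) (c * x) = c ^ n * poly (char_poly M) x"
proof -
  have "- char_matrix (c \<cdot>\<^sub>m M) (c * x) = c \<cdot>\<^sub>m (- char_matrix M x)"
    using M by (intro eq_matI) (auto simp: char_matrix_def algebra_simps)
  then show ?thesis
    using M by (simp add: char_poly_matrix[of _ n] char_matrix_def)
qed

text \<open>Once \<open>char_poly M\<close> is a product of linear factors, both sides can be
  compared as polynomial functions, which determine polynomials over the infinite field of
  reals.\<close>

lemma sym_mat_proots_char_poly_smult:
  assumes M: "M \<in> carrier_mat n n" and sym: "sym_mat M" and c: "c \<noteq> 0"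
  shows "proots (char_poly (c \<cdot>\<^sub>m M)) = image_mset ((*) c) (proots (char_poly M))"
proof -
  define R where "R = proots (char_poly M)"
  have R: "char_poly M = (\<Prod>a\<in>#R. [:- a, 1:])" "size R = n"
    using sym_mat_char_poly_splits[OF M sym] by (simp_all add: R_def)
  have "poly (char_poly (c \<cdot>\<^sub>m M)) y = poly (\<Prod>a\<in>#image_mset ((*) c) R. [:- a, 1:]) y" for y
  proof -
    have "poly (char_poly (c \<cdot>\<^sub>m M)) y = c ^ size R * (\<Prod>a\<in>#R. y / c - a)"
      using poly_char_poly_smult[OF M c, of "y / c"] c
      by (simp add: R poly_prod_mset image_mset.compositionality comp_def)
    \<comment> \<open>The power of \<open>c\<close> supplies exactly one \<open>c\<close> to each
      factor \<open>y / c - a\<close>.\<close>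
    also have "\<dots> = (\<Prod>a\<in>#R. y - c * a)"
      using c by (induction R) (auto simp: field_simps)
    also have "\<dots> = poly (\<Prod>a\<in>#image_mset ((*) c) R. [:- a, 1:]) y"
      by (simp add: poly_prod_mset image_mset.compositionality comp_def)
    finally show ?thesis .
  qed
  then have "char_poly (c \<cdot>\<^sub>m M) = (\<Prod>a\<in>#image_mset ((*) c) R. [:- a, 1:])"
    by (simp add: poly_eq_poly_eq_iff[symmetric] fun_eq_iff)
  then show ?thesis
    by (simp only: proots_linear_factors R_def)
qed

text \<open>Multiplication by a positive \<open>c\<close> preserves order, so the scaled list is
  still sorted and each eigenvalue keeps its rank.\<close>

lemma eig_smult:
  assumes M: "M \<in> carrier_mat n n" and sym: "sym_mat M" and c: "0 < c" and l: "1 \<le> l" "l \<le> n"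
  shows "eig l (c \<cdot>\<^sub>m M) = c * eig l M"
proof -
  let ?L = "sorted_list_of_multiset (proots (char_poly M))"
  have len: "length ?L = n"
    using sym_mat_char_poly_splits(2)[OF M sym] by (simp flip: size_mset)
  have "sorted (map ((*) c) ?L)"
    using c by (auto simp: sorted_map intro!: sorted_wrt_mono_rel[OF _ sorted_sorted_list_of_multiset])
  then have "sorted_list_of_multiset (image_mset ((*) c) (proots (char_poly M))) = map ((*) c) ?L"
    by (metis mset_map mset_sorted_list_of_multiset sorted_list_of_multiset_mset sorted_sort_id)
  then show ?thesis
    using sym_mat_proots_char_poly_smult[OF M sym] c l len by (simp add: eig_def rev_map)
qed

text \<open>Makes the logarithms in the objective genuine. For an eigenvector \<open>v\<close>, the
  positive quadratic form equals the eigenvalue times \<open>v \<bullet> v\<close>.\<close>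

lemma pd_mat_eig_pos:
  assumes M: "M \<in> carrier_mat n n" and pd: "pd_mat M" and l: "1 \<le> l" "l \<le> n"
  shows "0 < eig l M"
proof -
  let ?L = "sorted_list_of_multiset (proots (char_poly M))"
  have "length ?L = n"
    using sym_mat_char_poly_splits(2)[OF M] pd by (simp add: pd_mat_def flip: size_mset)
  then have "eig l M \<in> set (rev ?L)"
    unfolding eig_def using l by (intro nth_mem) simp
  then have "eig l M \<in># proots (char_poly M)"
    by simp
  moreover have "char_poly M \<noteq> 0"
    using degree_monic_char_poly[OF M] by auto
  ultimately have "eigenvalue M (eig l M)"
    by (simp add: eigenvalue_root_char_poly[OF M])
  then obtain v where v: "v \<in> carrier_vec n" "v \<noteq> 0\<^sub>v n" "M *\<^sub>v v = eig l M \<cdot>\<^sub>v v"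
    using M unfolding eigenvalue_def eigenvector_def by auto
  have "0 < v \<bullet> (M *\<^sub>v v)"
    using pd v M unfolding pd_mat_def by auto
  then have "0 < eig l M * (v \<bullet> v)"
    using v by simp
  moreover have "0 \<le> v \<bullet> v"
    by (simp add: scalar_prod_def sum_nonneg)
  ultimately show ?thesis
    by (simp add: zero_less_mult_iff)
qed

lemma transpose_smult_mat: "(c \<cdot>\<^sub>m M)\<^sup>T = c \<cdot>\<^sub>m M\<^sup>T"
  by (intro eq_matI) auto

lemma pd_mat_smult:
  assumes "pd_mat M" and "0 < c"
  shows "pd_mat (c \<cdot>\<^sub>m M)"
proof -
  have "x \<bullet> (c \<cdot>\<^sub>m M *\<^sub>v x) = c * (x \<bullet> (M *\<^sub>v x))" if "x \<in> carrier_vec (dim_row M)" for x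
  proof -
    have "c \<cdot>\<^sub>m M *\<^sub>v x = c \<cdot>\<^sub>v (M *\<^sub>v x)"
      using that assms by (intro eq_vecI) (auto simp: pd_mat_def sym_mat_def)
    then show ?thesis
      using that by simp
  qed
  then show ?thesis
    using assms by (auto simp: pd_mat_def sym_mat_def transpose_smult_mat)
qed

text \<open>By \<open>s \<le> k\<close> the subtraction \<open>k - s\<close> does not truncate, so
  the sum has exactly \<open>s\<close> terms, each contributing one \<open>ln c\<close>.\<close>

lemma DFact_objective_smult:
  assumes M: "M \<in> carrier_mat k k" and pd: "pd_mat M" and c: "0 < c" and s: "s \<le> k"
  shows "DFact_objective s b (c \<cdot>\<^sub>m M) \<nu> \<pi> \<tau> = DFact_objective s b M \<nu> \<pi> \<tau> - real s * ln c"
proof -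
  have "ln (eig l (c \<cdot>\<^sub>m M)) = ln c + ln (eig l M)" if "l \<in> {k - s + 1..k}" for l
    using that eig_smult[OF M _ c, of l] pd_mat_eig_pos[OF M pd, of l] pd c
    by (simp add: pd_mat_def ln_mult)
  then have "(\<Sum>l = k - s + 1..k. ln (eig l (c \<cdot>\<^sub>m M))) = real s * ln c + (\<Sum>l = k - s + 1..k. ln (eig l M))"
    using s by (simp add: sum.distrib)
  then show ?thesis
    using M by (simp add: DFact_objective_def)
qed

lemma DFact_feasible_scale:
  assumes F: "F \<in> carrier_mat n k" and \<gamma>: "0 < \<gamma>"
    and feas: "(\<Theta>, \<upsilon>, \<nu>, \<pi>, \<tau>) \<in> DFact_feasible C A F"
  shows "((1 / \<gamma>) \<cdot>\<^sub>m \<Theta>, \<upsilon>, \<nu>, \<pi>, \<tau>) \<in> DFact_feasible (\<gamma> \<cdot>\<^sub>m C) A (sqrt \<gamma> \<cdot>\<^sub>m F)"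
proof -
  have \<Theta>: "\<Theta> \<in> carrier_mat k k"
    using feas F by (simp add: DFact_feasible_def)
  have FT: "F\<^sup>T \<in> carrier_mat k n"
    using F by simp
  have "(sqrt \<gamma> \<cdot>\<^sub>m F) * ((1 / \<gamma>) \<cdot>\<^sub>m \<Theta>) * (sqrt \<gamma> \<cdot>\<^sub>m F)\<^sup>T
      = (sqrt \<gamma> * (1 / \<gamma>) * sqrt \<gamma>) \<cdot>\<^sub>m (F * \<Theta> * F\<^sup>T)"
    using F FT \<Theta> by (intro eq_matI) (simp_all add: transpose_smult_mat algebra_simps
      mult_smult_assoc_mat[of _ n k _ k] mult_smult_distrib[of _ n k _ k]
      mult_smult_assoc_mat[of _ n k _ n] mult_smult_distrib[of _ n k _ n])
  also have "\<dots> = F * \<Theta> * F\<^sup>T"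
    using \<gamma> by (intro eq_matI) (auto simp: field_simps)
  finally show ?thesis
    using feas pd_mat_smult[of \<Theta> "1 / \<gamma>"] \<gamma> by (simp add: DFact_feasible_def)
qed

text \<open>Each feasible point yields a competitor in the scaled program. The shift is finite, so
  infinite optimal values need no separate case.\<close>

lemma z_DFact_scale_le:
  assumes F: "F \<in> carrier_mat n k" and s: "s \<le> k" and \<gamma>: "0 < \<gamma>"
  shows "z_DFact (\<gamma> \<cdot>\<^sub>m C) s A b (sqrt \<gamma> \<cdot>\<^sub>m F) - ereal (real s * ln \<gamma>) \<le> z_DFact C s A b F"
    (is "?z' - _ \<le> _")
  unfolding z_DFact_def[of C]
proof (rule INF_greatest, clarify)
  fix \<Theta> \<upsilon> \<nu> \<pi> \<tau>
  assume feas: "(\<Theta>, \<upsilon>, \<nu>, \<pi>, \<tau>) \<in> DFact_feasible C A F"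
  then have "\<Theta> \<in> carrier_mat k k" "pd_mat \<Theta>"
    using F by (simp_all add: DFact_feasible_def)
  \<comment> \<open>The scaling factor is \<open>1 / \<gamma>\<close>, whose logarithm is
    \<open>- ln \<gamma>\<close>; hence the plus sign.\<close>
  then have obj: "DFact_objective s b ((1 / \<gamma>) \<cdot>\<^sub>m \<Theta>) \<nu> \<pi> \<tau>
      = DFact_objective s b \<Theta> \<nu> \<pi> \<tau> + real s * ln \<gamma>"
    using DFact_objective_smult[of \<Theta> k "1 / \<gamma>"] s \<gamma> by (simp add: ln_div)
  have "?z' \<le> ereal (DFact_objective s b ((1 / \<gamma>) \<cdot>\<^sub>m \<Theta>) \<nu> \<pi> \<tau>)"
    unfolding z_DFact_def using DFact_feasible_scale[OF F \<gamma> feas] by (rule INF_lower2) simp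
  then show "?z' - ereal (real s * ln \<gamma>) \<le> ereal (DFact_objective s b \<Theta> \<nu> \<pi> \<tau>)"
    by (simp add: obj ereal_minus_le)
qed

theorem theorem2p1:
  fixes n m k s :: nat and C A F :: "real mat" and b :: "real vec" and \<gamma> :: real
  assumes "1 < n" and "0 < s" and "s < n"
    and "C \<in> carrier_mat n n" and "psd_mat C" and "s \<le> vec_space.rank n C"
    and "A \<in> carrier_mat m n" and "b \<in> carrier_vec m"
    and "F \<in> carrier_mat n k" and "vec_space.rank n C \<le> k" and "k \<le> n" and "C = F * F\<^sup>T"
    and "0 < \<gamma>"
  shows "z_DFact C s A b F
       = z_DFact (\<gamma> \<cdot>\<^sub>m C) s A b (sqrt \<gamma> \<cdot>\<^sub>m F) - ereal (real s * ln \<gamma>)"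
proof (rule antisym)
  let ?z' = "z_DFact (\<gamma> \<cdot>\<^sub>m C) s A b (sqrt \<gamma> \<cdot>\<^sub>m F)"
  \<comment> \<open>The rank of \<open>C\<close> lies between \<open>s\<close> and
    \<open>k\<close>.\<close>
  have s: "s \<le> k"
    using assms by simp
  show "?z' - ereal (real s * ln \<gamma>) \<le> z_DFact C s A b F"
    using z_DFact_scale_le assms s by blast
  have "(1 / \<gamma>) \<cdot>\<^sub>m (\<gamma> \<cdot>\<^sub>m C) = C" "sqrt (1 / \<gamma>) \<cdot>\<^sub>m (sqrt \<gamma> \<cdot>\<^sub>m F) = F"
    using \<open>0 < \<gamma>\<close> by (auto simp: real_sqrt_divide intro!: eq_matI)
  \<comment> \<open>Scaling by \<open>1 / \<gamma>\<close> returns to \<open>C\<close> and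
    \<open>F\<close>, and \<open>ln (1 / \<gamma>)\<close> turns the subtracted shift into an added
    one.\<close>
  then have "z_DFact C s A b F + ereal (real s * ln \<gamma>) \<le> ?z'"
    using z_DFact_scale_le[of "sqrt \<gamma> \<cdot>\<^sub>m F" n k s "1 / \<gamma>" "\<gamma> \<cdot>\<^sub>m C" A b] assms s
    by (simp add: ln_div minus_ereal_def)
  then show "z_DFact C s A b F \<le> ?z' - ereal (real s * ln \<gamma>)"
    by (simp add: ereal_le_minus)
qed

end
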